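(* Let $n\ge 2$ be an integer and let $\mathfrak{A}$ be a unital $2$-torsion free prime ring with a nontrivial idempotent. Then for every multiplicative generalized Jordan $n$-derivation $\Delta:\mathfrak{A}\rightarrow\mathfrak{A}$ there exist $\mu\in\mathcal{Z}(\mathfrak{A})$ and a derivation $\delta:\mathfrak{A}\rightarrow\mathfrak{A}$ such that $\Delta(t)=\mu t+\delta(t)$ for all $t\in\mathfrak{A}$.
   Context: Rings are associative with identity; $\mathcal{Z}(\mathfrak{A})$ is the center of $\mathfrak{A}$. A ring is $2$-torsion free if $2t=0$ implies $t=0$. An idempotent is nontrivial if it is different from $0$ and $1$. A ring $\mathfrak{A}$ is prime if, for any $u,v\in\mathfrak{A}$, $u\mathfrak{A}v=\{0\}$ implies $u=0$ or $v=0$. The Jordan product is $t_1\circ t_2=t_1t_2+t_2t_1$. Set $q_1(t_1)=t_1$ and $q_n(t_1,\ldots,t_n)=q_{n-1}(t_1,\ldots,t_{n-1})\circ t_n$ for $n\ge 2$. A map $\delta:\mathfrak{A}\to\mathfrak{A}$ (not assumed additive) is a multiplicative Jordan $n$-derivation if $\delta(q_n(t_1,\ldots,t_n))=\sum_{i=1}^n q_n(t_1,\ldots,t_{i-1},\delta(t_i),t_{i+1},\ldots,t_n)$ for all $t_1,\ldots,t_n\in\mathfrak{A}$. A map $\Delta:\mathfrak{A}\to\mathfrak{A}$ (not assumed additive) is a multiplicative generalized Jordan $n$-derivation if there exists a multiplicative Jordan $n$-derivation $\delta:\mathfrak{A}\to\mathfrak{A}$ (not assumed additive) such that $\Delta(q_n(t_1,\ldots,t_n))=q_n(\Delta(t_1),t_2,\ldots,t_n)+\sum_{i=2}^n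 q_n(t_1,\ldots,t_{i-1},\delta(t_i),t_{i+1},\ldots,t_n)$ for all $t_1,\ldots,t_n\in\mathfrak{A}$. A derivation is an additive map $d$ with $d(t_1t_2)=d(t_1)t_2+t_1d(t_2)$ for all $t_1,t_2$. *)

theory Defs
  imports Complex_Main
begin

(* Rings are types of class ring_1 (associative with identity, not necessarily commutative).
   This class assumes 0 \<noteq> 1, so it omits the zero ring, which has no nontrivial idempotent. *)

definition ring_center :: "'a::ring_1 set" where
  "ring_center = {z. \<forall>x. z * x = x * z}"

definition two_torsion_free :: "'a::ring_1 itself \<Rightarrow> bool" where
  "two_torsion_free _ \<longleftrightarrow> (\<forall>t::'a. 2 * t = 0 \<longrightarrow> t = 0)"

definition is_prime_ring :: "'a::ring_1 itself \<Rightarrow> bool" where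
  "is_prime_ring _ \<longleftrightarrow> (\<forall>u v::'a. (\<forall>x. u * x * v = 0) \<longrightarrow> u = 0 \<or> v = 0)"

definition nontrivial_idempotent :: "'a::ring_1 \<Rightarrow> bool" where
  "nontrivial_idempotent e \<longleftrightarrow> e * e = e \<and> e \<noteq> 0 \<and> e \<noteq> 1"

definition jordan_prod :: "'a::ring_1 \<Rightarrow> 'a \<Rightarrow> 'a" where
  "jordan_prod x y = x * y + y * x"

(* The tuple (t_1, ..., t_n) is given by a sequence t of which only the entries t 1, ..., t n
   are used; replacing the i-th entry by x is the function update t(i := x).
   The value at n = 0 is a dummy. *)
fun jordan_q :: "nat \<Rightarrow> (nat \<Rightarrow> 'a::ring_1) \<Rightarrow> 'a" where
  "jordan_q 0 t = 0"
| "jordan_q (Suc 0) t = t 1"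
| "jordan_q (Suc (Suc n)) t = jordan_prod (jordan_q (Suc n) t) (t (Suc (Suc n)))"

definition mult_jordan_derivation :: "nat \<Rightarrow> ('a::ring_1 \<Rightarrow> 'a) \<Rightarrow> bool" where
  "mult_jordan_derivation n \<delta> \<longleftrightarrow>
    (\<forall>t. \<delta> (jordan_q n t) = (\<Sum>i=1..n. jordan_q n (t(i := \<delta> (t i)))))"

definition mult_gen_jordan_derivation :: "nat \<Rightarrow> ('a::ring_1 \<Rightarrow> 'a) \<Rightarrow> bool" where
  "mult_gen_jordan_derivation n \<Delta> \<longleftrightarrow>
    (\<exists>\<delta>. mult_jordan_derivation n \<delta> \<and>
      (\<forall>t. \<Delta> (jordan_q n t) =
        jordan_q n (t(1 := \<Delta> (t 1))) + (\<Sum>i=2..n. jordan_q n (t(i := \<delta> (t i))))))"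

definition ring_derivation :: "('a::ring_1 \<Rightarrow> 'a) \<Rightarrow> bool" where
  "ring_derivation d \<longleftrightarrow> additive d \<and> (\<forall>x y. d (x * y) = d x * y + x * d y)"

end

theory Submission
  imports Defs
begin

text \<open>
  Write \<open>x \<odot> y\<close> for the Jordan product. Filling all but the first two arguments of \<open>jordan_q n\<close> with
  \<open>1\<close> turns it into \<open>2\<^sup>k (x \<odot> y)\<close> with \<open>k = n - 2\<close>. In the identity for \<open>\<delta>\<close>, the terms in which
  \<open>\<delta>\<close> hits one of those \<open>1\<close>s depend on \<open>x \<odot> y\<close> only, say as \<open>R (x \<odot> y)\<close>. So with
  \<open>D w = \<delta> (2\<^sup>k w) - R w\<close> and \<open>G = 2\<^sup>k \<delta>\<close> it becomes an equation between two functions in which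
  \<open>n\<close> no longer occurs:
  \<open>D (x \<odot> y) = G x \<odot> y + x \<odot> G y\<close>. The same terms \<open>R\<close> occur for \<open>\<Delta>\<close>, so that
  \<open>\<Delta> - \<delta>\<close> satisfies an equation of the form \<open>H (x \<odot> y) = F x \<odot> y\<close>.

  The second equation is easy. It forces \<open>2 F x = F 1 \<odot> x\<close>, and symmetry of the left-hand side in
  \<open>x\<close> and \<open>y\<close> makes \<open>F 1\<close> commute with all commutators, hence (in a prime ring) central
  (\<open>jordan_multiplier\<close>). So \<open>\<Delta> - \<delta>\<close> is multiplication by a central element.

  The first equation says that \<open>G\<close> is multiplication by a central element plus a derivation
  (\<open>pexider_jordan_derivation\<close>). Comparing \<open>g \<odot> g = g \<odot> 1\<close> for an idempotent \<open>g\<close> shows that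
  \<open>G 1\<close> commutes with every idempotent, and the idempotents \<open>e\<close>, \<open>e + e x f\<close>, \<open>e + f x e\<close> (with
  \<open>f = 1 - e\<close>) suffice to make it central. After subtracting \<open>G 1\<close> times the identity and an inner
  derivation, \<open>G\<close> kills \<open>e\<close> and \<open>f\<close>. Then \<open>e \<odot> G x = D (e \<odot> x)\<close> and \<open>f \<odot> G x = D (f \<odot> x)\<close>, which
  tie \<open>G\<close> to the Peirce decomposition; testing the additivity defect of \<open>G\<close> against the corner
  \<open>e A f\<close>, which has zero annihilator in \<open>e A e\<close> by primeness, gives additivity (\<open>G_add\<close>). Finally \<open>G\<close>
  commutes with multiplication by \<open>e\<close> (\<open>G_e_left\<close>), and its Leibniz defect, being
  antisymmetric and compatible with the Peirce projections, vanishes (\<open>G_mult\<close>).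

  Unlike a derivation, \<open>\<delta>\<close> need not kill \<open>1\<close>: if \<open>(n - 1) c = 0\<close> with \<open>c\<close> central, then
  \<open>x \<mapsto> c x\<close> is a Jordan \<open>n\<close>-derivation. The central element in the conclusion collects
  \<open>\<delta> 1\<close> as well.
\<close>

section \<open>The Jordan product and primeness\<close>

notation jordan_prod (infixl "\<odot>" 70)

lemma jordan_add_left: "(x + y) \<odot> z = x \<odot> z + y \<odot> (z::'a::ring_1)"
  and jordan_add_right: "z \<odot> (x + y) = z \<odot> x + z \<odot> y"
  and jordan_diff_left: "(x - y) \<odot> z = x \<odot> z - y \<odot> z"
  and jordan_diff_right: "z \<odot> (x - y) = z \<odot> x - z \<odot> y"
  and jordan_commute: "x \<odot> y = y \<odot> x"
  and jordan_zero_left [simp]: "0 \<odot> x = 0"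
  and jordan_zero_right [simp]: "x \<odot> 0 = 0"
  and jordan_one_right [simp]: "x \<odot> 1 = x + x"
  and jordan_one_left [simp]: "1 \<odot> x = x + x"
  by (simp_all add: jordan_prod_def algebra_simps)

text \<open>
  The parameter only carries the type: the assumptions concern the whole ring, and torsion is
  phrased by \<open>x + x\<close>, the form in which it arises from \<open>x \<odot> 1\<close>.
\<close>

locale prime_ring_two_free =
  fixes ring_type :: "'a::ring_1 itself"
  assumes double_zero: "x + x = 0 \<Longrightarrow> x = (0::'a)"
    and prime: "(\<And>x. u * x * v = 0) \<Longrightarrow> u = 0 \<or> v = (0::'a)"
begin

lemma double_cancel: "x + x = y + y \<Longrightarrow> x = (y::'a)"
  using double_zero[of "x - y"] by (simp add: algebra_simps)

lemma power_two_cancel: "2 ^ k * x = 0 \<Longrightarrow> x = (0::'a)"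
proof (induction k)
  case (Suc k)
  then have "2 ^ k * x + 2 ^ k * x = 0"
    by (simp add: mult_2 distrib_right)
  with Suc.IH double_zero show ?case by blast
qed simp

text \<open>
  Since \<open>t [t, s] = [t, t s]\<close> is again a commutator, \<open>[a, t] [t, s] = 0\<close> for all \<open>s\<close>. Replacing \<open>s\<close> by
  \<open>s r\<close> gives \<open>[a, t] s [t, r] = 0\<close>, and primeness at \<open>r = a\<close> leaves \<open>[a, t] = 0\<close>.
\<close>

lemma central_if_commutes_with_commutators:
  fixes a :: 'a
  assumes comm: "\<And>s t. a * (s * t - t * s) = (s * t - t * s) * a"
  shows "a \<in> ring_center"
proof -
  have "a * t = t * a" for t
  proof -
    have 1: "(a * t - t * a) * (t * s - s * t) = 0" for s
    proof -
      let ?c = "t * s - s * t"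
      have tc: "t * (t * s) - (t * s) * t = t * ?c" by (simp add: algebra_simps)
      have "a * (t * ?c) = t * ?c * a" using comm[of t "t * s"] unfolding tc .
      also have "\<dots> = t * (a * ?c)" using comm[of t s] by (simp add: mult.assoc)
      finally show ?thesis by (simp add: left_diff_distrib mult.assoc)
    qed
    have 2: "(a * t - t * a) * s * (t * r - r * t) = 0" for s r
    proof -
      have "(a * t - t * a) * s * (t * r - r * t)
          = (a * t - t * a) * (t * (s * r) - (s * r) * t) - (a * t - t * a) * (t * s - s * t) * r"
        by (simp add: algebra_simps)
      then show ?thesis by (simp add: 1)
    qed
    have "a * t - t * a = 0 \<or> t * a - a * t = 0"
      by (rule prime) (rule 2)
    then show ?thesis by auto
  qed
  then show ?thesis by (simp add: ring_center_def)
qed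

end

section \<open>Peirce decomposition along an idempotent\<close>

text \<open>
  The complementary idempotents enter symmetrically, so that each statement about the corners
  \<open>e A e\<close> and \<open>e A f\<close> yields by interchange the one about \<open>f A f\<close> and \<open>f A e\<close>. Corner elements are written
  out as \<open>e * x * f\<close> and so on: the rules below then rewrite words to a normal form.
\<close>

locale peirce = prime_ring_two_free "TYPE('a)" for e f :: "'a::ring_1" +
  assumes ee [simp]: "e * e = e" and ff [simp]: "f * f = f"
    and ef [simp]: "e * f = 0" and fe [simp]: "f * e = 0"
    and sum_ef: "e + f = 1" and e_nz: "e \<noteq> 0" and f_nz: "f \<noteq> 0"
begin

lemma peirce_swap: "peirce f e"
  by unfold_locales (simp_all add: sum_ef add.commute e_nz f_nz)

lemma absorb [simp]:
  "e * (e * x) = e * x" "f * (f * x) = f * x" "e * (f * x) = 0" "f * (e * x) = 0"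
  by (simp_all add: mult.assoc[symmetric])

lemma split_left: "x = e * x + f * x"
  using sum_ef by (metis distrib_right mult_1_left)

lemma split_right: "x = x * e + x * f"
  using sum_ef by (metis distrib_left mult_1_right)

lemma peirce_decomposition: "x = e * x * e + e * x * f + f * x * e + f * x * f"
  using split_left[of x] split_right[of "e * x"] split_right[of "f * x"] by (simp add: add.assoc)

lemma annihilates_corner_right: "(\<And>x. u * (e * x * f) = 0) \<Longrightarrow> u * e = 0"
  using prime[of "u * e" f] f_nz by (auto simp: mult.assoc)

lemma jordan_split: "x + x = e \<odot> x + f \<odot> x"
  using sum_ef by (metis jordan_add_left jordan_one_left)

lemma jordan_e_zero:
  assumes "e \<odot> x = 0" shows "e * x = 0" "x * e = 0"
proof -
  have 0: "e * x = - (x * e)"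
    using assms by (simp add: jordan_prod_def eq_neg_iff_add_eq_0)
  have "e * x = e * (- (x * e))" using arg_cong[OF 0, of "\<lambda>y. e * y"] by simp
  then have 1: "e * x = - (e * x * e)" by (metis mult_minus_right mult.assoc)
  have 2: "e * x * e = - (x * e)"
    using arg_cong[OF 0, of "\<lambda>y. y * e"] by (simp only: ee mult.assoc mult_minus_left)
  have "e * x * e + e * x * e = 0" using 0 1 2 by (metis add.right_inverse minus_minus)
  then have "e * x * e = 0" by (rule double_zero)
  with 1 2 show "e * x = 0" "x * e = 0" by simp_all
qed

text \<open>
  Applied to \<open>e\<close>, \<open>e + e x f\<close> and \<open>e + f x e\<close> the hypothesis shows that \<open>z\<close> commutes with the
  off-diagonal corners. For \<open>a\<close> in \<open>e A e\<close> and \<open>b\<close> in \<open>e A f\<close> also \<open>a b\<close> is in \<open>e A f\<close>, so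
  \<open>[z, a] b = [z, a b] - a [z, b] = 0\<close>, and \<open>[z, a] = 0\<close> by primeness.
\<close>

lemma central_if_commutes_with_idempotents:
  fixes z :: 'a
  assumes comm: "\<And>g. g * g = g \<Longrightarrow> z * g = g * z"
  shows "z \<in> ring_center"
proof -
  have ze: "z * e = e * z" and zf: "z * f = f * z" by (simp_all add: comm)
  have c12: "z * (e * x * f) = e * x * f * z" for x
    using comm[of "e + e * x * f"] ze by (simp add: algebra_simps)
  have c21: "z * (f * x * e) = f * x * e * z" for x
    using comm[of "e + f * x * e"] ze by (simp add: algebra_simps)
  have c11: "z * (e * x * e) = e * x * e * z" for x
  proof -
    let ?u = "z * (e * x * e) - e * x * e * z"
    have "?u * (e * y * f) = 0" for y
      using c12[of "x * e * y"] c12[of y]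
      by (simp add: algebra_simps)
    then have "?u * e = 0" by (rule annihilates_corner_right)
    then show ?thesis using ze by (simp add: algebra_simps)
  qed
  have c22: "z * (f * x * f) = f * x * f * z" for x
  proof -
    let ?u = "z * (f * x * f) - f * x * f * z"
    have "?u * (f * y * e) = 0" for y
      using c21[of "x * f * y"] c21[of y]
      by (simp add: algebra_simps)
    then have "?u * f = 0" by (rule peirce.annihilates_corner_right[OF peirce_swap])
    then show ?thesis using zf by (simp add: algebra_simps)
  qed
  have "z * x = x * z" for x
    by (subst (1 2) peirce_decomposition[of x]) (simp only: distrib_left distrib_right c11 c12 c21 c22)
  then show ?thesis by (simp add: ring_center_def)
qed

end

section \<open>Additivity of the solutions of the Jordan equation\<close>

text \<open>
  The normalization \<open>G e = G f = 0\<close> is reached from a general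
  solution by subtracting a central multiplication and an inner derivation.
\<close>

locale jordan_pexider = peirce e f for e f :: "'a::ring_1" +
  fixes D G :: "'a \<Rightarrow> 'a"
  assumes pexider: "D (x \<odot> y) = G x \<odot> y + x \<odot> G y"
    and G_e [simp]: "G e = 0" and G_f [simp]: "G f = 0"
begin

lemma swap: "jordan_pexider f e D G"
  using peirce_swap by (simp add: jordan_pexider_def jordan_pexider_axioms_def pexider)

lemma D_0 [simp]: "D 0 = 0"
proof -
  have "D (0 \<odot> 0) = 0" unfolding pexider by simp
  then show ?thesis by simp
qed

lemma e_G: "e \<odot> G x = D (e \<odot> x)" by (simp add: pexider)
lemma f_G: "f \<odot> G x = D (f \<odot> x)" by (simp add: pexider)

lemma G_0 [simp]: "G 0 = 0"
proof (rule double_zero)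
  show "G 0 + G 0 = 0" by (simp add: jordan_split[of "G 0"] e_G f_G)
qed

lemma G_1 [simp]: "G 1 = 0"
proof (rule double_zero)
  have "e \<odot> G 1 = 0" "f \<odot> G 1 = 0"
    using pexider[of e e] pexider[of f f] by (simp_all add: e_G f_G) (simp_all add: jordan_prod_def)
  then show "G 1 + G 1 = 0" by (simp add: jordan_split[of "G 1"])
qed

lemma D_double: "D (x + x) = G x + G x"
  using pexider[of x 1] by simp

text \<open>
  Evaluating \<open>D\<close> at \<open>x \<odot> (s + s)\<close>, which is also \<open>(x \<odot> s) \<odot> 1\<close>, in two ways removes \<open>D\<close>. Any failure
  of additivity in \<open>x\<close> of the left-hand side comes from \<open>G x\<close> alone, so that the next lemma can test
  additivity of \<open>G\<close> by Jordan multiplication.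
\<close>

lemma double_test: "G x \<odot> s + G x \<odot> s + x \<odot> G (s + s) = G (x \<odot> s) + G (x \<odot> s)"
  using pexider[of x "s + s"] D_double[of "x \<odot> s"] by (simp add: jordan_add_right)

lemma additivity_defect_jordan:
  "(G (x + y) - G x - G y) \<odot> s = G ((x + y) \<odot> s) - G (x \<odot> s) - G (y \<odot> s)"
proof (rule double_cancel)
  let ?T = "G (x + y) - G x - G y"
  have "?T \<odot> s + ?T \<odot> s
      = (G (x + y) \<odot> s + G (x + y) \<odot> s + (x + y) \<odot> G (s + s))
        - (G x \<odot> s + G x \<odot> s + x \<odot> G (s + s)) - (G y \<odot> s + G y \<odot> s + y \<odot> G (s + s))"
    by (simp add: jordan_add_left jordan_diff_left)
  then show "?T \<odot> s + ?T \<odot> s =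
    G ((x + y) \<odot> s) - G (x \<odot> s) - G (y \<odot> s) + (G ((x + y) \<odot> s) - G (x \<odot> s) - G (y \<odot> s))"
    unfolding double_test by simp
qed

text \<open>
  The off-diagonal part of an element is thus expressed by Jordan multiplications alone, and
  \<open>e \<odot> x = x\<close> characterizes the off-diagonal elements.
\<close>

lemma off_part: "e \<odot> (f \<odot> x) = e * x * f + f * x * e"
  by (simp add: jordan_prod_def algebra_simps)

lemma jordan_ef_swap: "e \<odot> (f \<odot> x) = f \<odot> (e \<odot> x)"
  by (simp add: jordan_prod_def algebra_simps)

lemma G_off:
  assumes "e \<odot> x = x" shows "e \<odot> G x = G x" "f \<odot> G x = G x" "D x = G x"
proof -
  have "f \<odot> x = x" using jordan_split[of x] assms by simp
  then have 1: "e \<odot> G x = D x" "f \<odot> G x = D x" using assms by (simp_all add: e_G f_G)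
  then have "G x + G x = D x + D x" using jordan_split[of "G x"] by simp
  then have "G x = D x" by (rule double_cancel)
  then show "e \<odot> G x = G x" "f \<odot> G x = G x" "D x = G x" using 1 by simp_all
qed

text \<open>
  Because \<open>f \<odot> G x = D (f \<odot> x)\<close> does not depend on the \<open>e A e\<close> part of \<open>x\<close>, and \<open>e \<odot> G x\<close> not on its
  \<open>f A f\<close> part, the off-diagonal part of \<open>G x\<close> sees neither diagonal part once \<open>e \<odot> _\<close> and \<open>f \<odot> _\<close> are
  both applied.
\<close>

lemma G_off_part: "e \<odot> (f \<odot> G x) = G (e \<odot> (f \<odot> x))"
proof -
  let ?o = "e \<odot> (f \<odot> x)" and ?h = "f * x * f"
  have o: "e \<odot> ?o = ?o" "f \<odot> ?o = ?o" by (simp_all add: jordan_prod_def algebra_simps)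
  have "f \<odot> x = f \<odot> (?o + ?h)"
    by (subst peirce_decomposition[of x]) (simp add: jordan_prod_def algebra_simps)
  then have "e \<odot> (f \<odot> G x) = e \<odot> (f \<odot> G (?o + ?h))" by (simp add: f_G)
  also have "\<dots> = f \<odot> (e \<odot> G (?o + ?h))" by (rule jordan_ef_swap)
  also have "e \<odot> G (?o + ?h) = e \<odot> G ?o"
    by (simp add: e_G) (simp add: jordan_prod_def algebra_simps)
  also have "f \<odot> (e \<odot> G ?o) = G ?o" using G_off[OF o(1)] by simp
  finally show ?thesis .
qed

lemma G_11: "f * G (e * x * e) = 0" "G (e * x * e) * f = 0" 
    "e * G (e * x * e) = G (e * x * e)" "G (e * x * e) * e = G (e * x * e)"
proof -
  have "f \<odot> G (e * x * e) = 0" by (simp add: f_G) (simp add: jordan_prod_def mult.assoc)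
  from peirce.jordan_e_zero[OF peirce_swap this]
  show 1: "f * G (e * x * e) = 0" "G (e * x * e) * f = 0" by auto
  show "e * G (e * x * e) = G (e * x * e)" "G (e * x * e) * e = G (e * x * e)"
    using split_left[of "G (e * x * e)"] split_right[of "G (e * x * e)"] 1 by simp_all
qed

lemma vanishes_11:
  assumes "f \<odot> T = 0" and "\<And>z. T \<odot> (e * z * f) = 0"
  shows "T = 0"
proof -
  have T: "f * T = 0" "T * f = 0" using peirce.jordan_e_zero[OF peirce_swap assms(1)] by auto
  have "T * (e * z * f) = 0" for z
  proof -
    have "e * z * f * T = 0" using T by (simp add: mult.assoc)
    then show ?thesis using assms(2)[of z] by (simp add: jordan_prod_def)
  qed
  then have "T * e = 0" by (rule annihilates_corner_right)
  then show ?thesis using split_right[of T] T by simp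
qed

text \<open>
  The additivity defect lies in \<open>e A e\<close> because \<open>f \<odot> _\<close> does not see \<open>e * x * e\<close>. Its Jordan products
  with \<open>s\<close> in \<open>e A f\<close> are off-diagonal, so only the off-diagonal parts in the test matter. These are
  additive: \<open>y \<odot> s\<close> is diagonal and \<open>G\<close> preserves off-diagonal parts.
\<close>

lemma G_add_11_off:
  assumes o: "e \<odot> y = y"
  shows "G (e * x * e + y) = G (e * x * e) + G y"
proof -
  let ?a = "e * x * e"
  let ?T = "G (?a + y) - G ?a - G y"
  have fa: "f \<odot> ?a = 0" by (simp add: jordan_prod_def mult.assoc)
  have T: "f \<odot> ?T = 0"
    by (simp add: jordan_diff_right f_G jordan_add_right fa)
  have "?T \<odot> (e * z * f) = 0" for z
  proof -
    let ?s = "e * z * f"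
    have fT: "f * ?T = 0" "?T * f = 0" using peirce.jordan_e_zero[OF peirce_swap T] by auto
    then have eT: "e * ?T = ?T" using split_left[of ?T] by simp
    have "?T \<odot> ?s = ?T * ?s" using fT by (simp add: jordan_prod_def mult.assoc)
    also have "\<dots> = e * (?T * ?s) * f" using eT by (metis mult.assoc ff)
    finally have Ts: "?T \<odot> ?s = e * (?T * ?s) * f" .
    have y: "y = e * y * f + f * y * e"
    proof -
      have "f \<odot> y = y" using jordan_split[of y] o by simp
      then show ?thesis using off_part[of y] o by simp
    qed
    have ys: "e \<odot> (f \<odot> (y \<odot> ?s)) = 0"
      by (subst y) (simp add: jordan_prod_def algebra_simps)
    have "?T \<odot> ?s = e \<odot> (f \<odot> (?T \<odot> ?s))"
      unfolding Ts by (simp add: jordan_prod_def algebra_simps)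
    also have "\<dots> = 0"
      unfolding additivity_defect_jordan
      by (simp add: jordan_diff_right G_off_part jordan_add_left jordan_add_right ys)
    finally show ?thesis .
  qed
  with T have "?T = 0" by (rule vanishes_11)
  then show ?thesis by (simp add: algebra_simps)
qed

text \<open>
  The elements \<open>e \<odot> G x\<close> and \<open>f \<odot> G x\<close> together determine \<open>2 G x\<close>, and each is insensitive to one
  diagonal part of \<open>x\<close>, so that the three-term case reduces to the two-term one.
\<close>

lemma G_decompose_off:
  "G x = G (e * x * e) + G (e * x * f + f * x * e) + G (f * x * f)"
proof (rule double_cancel)
  interpret sw: jordan_pexider f e D G by (rule swap)
  let ?a = "e * x * e" and ?o = "e * x * f + f * x * e" and ?h = "f * x * f"
  have o: "e \<odot> ?o = ?o" "f \<odot> ?o = ?o" by (simp_all add: jordan_prod_def algebra_simps)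
  have "e \<odot> x = e \<odot> (?a + ?o)" "f \<odot> x = f \<odot> (?h + ?o)"
    by (subst peirce_decomposition[of x], simp add: jordan_prod_def algebra_simps)+
  then have "e \<odot> G x = e \<odot> (G ?a + G ?o)" "f \<odot> G x = f \<odot> (G ?h + G ?o)"
    using G_add_11_off[OF o(1)] sw.G_add_11_off[OF o(2)]
    by (simp_all add: e_G[of x] f_G[of x]) (simp_all add: e_G[symmetric] f_G[symmetric])
  moreover have "e \<odot> G ?a = G ?a + G ?a" "f \<odot> G ?h = G ?h + G ?h"
    using G_11[of x] sw.G_11[of x] by (simp_all add: jordan_prod_def)
  ultimately show "G x + G x = G ?a + G ?o + G ?h + (G ?a + G ?o + G ?h)"
    using G_off[OF o(1)] jordan_split[of "G x"] by (simp add: jordan_add_right algebra_simps)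
qed

text \<open>
  The sum of two elements \<open>b\<close>, \<open>c\<close> of \<open>e A f\<close> is the Jordan product \<open>(e + b) \<odot> (f + c)\<close>, and \<open>G\<close>
  is known on both factors.
\<close>

lemma G_add_12: "G (e * (x + y) * f) = G (e * x * f) + G (e * y * f)"
proof -
  interpret sw: jordan_pexider f e D G by (rule swap)
  let ?b = "e * x * f" and ?c = "e * y * f"
  have o: "e \<odot> ?b = ?b" "e \<odot> ?c = ?c" "f \<odot> ?b = ?b" "f \<odot> ?c = ?c" "e \<odot> (?b + ?c) = ?b + ?c"
    by (simp_all add: jordan_prod_def algebra_simps)
  have Gb: "G (e + ?b) = G ?b" using G_add_11_off[OF o(1), of 1] by simp
  have Gc: "G (f + ?c) = G ?c" using sw.G_add_11_off[OF o(4), of 1] by simp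
  have z: "G ?b \<odot> ?c + ?b \<odot> G ?c = 0"
    by (simp add: pexider[symmetric]) (simp add: jordan_prod_def algebra_simps)
  have "(e + ?b) \<odot> (f + ?c) = ?b + ?c" by (simp add: jordan_prod_def algebra_simps)
  then have "G (?b + ?c) = D ((e + ?b) \<odot> (f + ?c))" using G_off[OF o(5)] by simp
  also have "\<dots> = G ?b \<odot> f + e \<odot> G ?c + (G ?b \<odot> ?c + ?b \<odot> G ?c)"
    unfolding pexider Gb Gc by (simp add: jordan_add_left jordan_add_right add_ac)
  also have "\<dots> = G ?b + G ?c"
    using G_off[OF o(1)] G_off[OF o(2)] z by (simp add: jordan_commute[of _ f])
  finally show ?thesis by (simp add: algebra_simps)
qed

text \<open>
  Jordan multiplication by \<open>s\<close> in \<open>e A f\<close> annihilates \<open>e * x * f\<close>, so the test degenerates and shows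
  that the defect \<open>T\<close> satisfies \<open>T \<odot> s = 0\<close>; being off-diagonal, it has no part in \<open>f A e\<close>.
\<close>

lemma additivity_defect_12_21:
  assumes "T = G (e * x * f + f * y * e) - G (e * x * f) - G (f * y * e)"
  shows "f * T * e = 0"
proof -
  have o: "e \<odot> (e * x * f) = e * x * f" "e \<odot> (f * y * e) = f * y * e"
     "e \<odot> (e * x * f + f * y * e) = e * x * f + f * y * e"
    by (simp_all add: jordan_prod_def algebra_simps)
  have eT: "e \<odot> T = T" unfolding assms using G_off(1)[OF o(1)] G_off(1)[OF o(2)] G_off(1)[OF o(3)]
    by (simp add: jordan_diff_right)
  have Ts: "T \<odot> (e * z * f) = 0" for z
  proof -
    have "(e * x * f) \<odot> (e * z * f) = 0" by (simp add: jordan_prod_def mult.assoc)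
    then show ?thesis unfolding assms additivity_defect_jordan by (simp add: jordan_add_left)
  qed
  have "(f * T * e) * (e * z * f) = 0" for z
  proof -
    have "f * (T \<odot> (e * z * f)) = (f * T * e) * (e * z * f)"
      by (simp add: jordan_prod_def algebra_simps)
    then show ?thesis using Ts[of z] by simp
  qed
  then have "f * T * e * e = 0" by (rule annihilates_corner_right)
  then show ?thesis by (simp add: mult.assoc)
qed

lemma G_add_12_21: "G (e * x * f + f * y * e) = G (e * x * f) + G (f * y * e)"
proof -
  interpret sw: jordan_pexider f e D G by (rule swap)
  define T where "T = G (e * x * f + f * y * e) - G (e * x * f) - G (f * y * e)"
  have o: "e \<odot> (e * x * f) = e * x * f" "e \<odot> (f * y * e) = f * y * e"
     "e \<odot> (e * x * f + f * y * e) = e * x * f + f * y * e"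
    by (simp_all add: jordan_prod_def algebra_simps)
  have eT: "e \<odot> T = T" "f \<odot> T = T" unfolding T_def using G_off[OF o(1)] G_off[OF o(2)] G_off[OF o(3)]
    by (simp_all add: jordan_diff_right)
  have 1: "f * T * e = 0" using additivity_defect_12_21 T_def .
  have 2: "e * T * f = 0" using sw.additivity_defect_12_21[of T y x] by (simp add: T_def add.commute algebra_simps)
  have "T = 0" using 1 2 off_part[of T] eT by simp
  then show ?thesis by (simp add: T_def algebra_simps)
qed

text \<open>
  Testing against \<open>e A f\<close> reduces to additivity there, as \<open>e A e\<close> maps \<open>e A f\<close> into itself.
\<close>

lemma G_add_11: "G (e * (x + y) * e) = G (e * x * e) + G (e * y * e)"
proof -
  let ?a = "e * x * e" and ?b = "e * y * e"
  let ?T = "G (?a + ?b) - G ?a - G ?b"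
  have ab: "?a + ?b = e * (x + y) * e" by (simp add: algebra_simps)
  have "f \<odot> ?T = 0"
    by (simp only: jordan_diff_right f_G) (simp add: jordan_prod_def algebra_simps)
  moreover have "?T \<odot> (e * z * f) = 0" for z
  proof -
    have "(?a + ?b) \<odot> (e * z * f) = e * (x * e * z + y * e * z) * f"
      "?a \<odot> (e * z * f) = e * (x * e * z) * f" "?b \<odot> (e * z * f) = e * (y * e * z) * f"
      by (simp_all add: jordan_prod_def algebra_simps)
    then show ?thesis unfolding additivity_defect_jordan by (simp only: G_add_12) simp
  qed
  ultimately have "?T = 0" by (rule vanishes_11)
  then show ?thesis unfolding ab by (simp add: algebra_simps)
qed

lemma G_decompose: "G x = G (e * x * e) + G (e * x * f) + G (f * x * e) + G (f * x * f)"
  by (subst G_decompose_off) (simp add: G_add_12_21 add.assoc)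

lemma G_add: "G (x + y) = G x + G y"
proof -
  interpret sw: jordan_pexider f e D G by (rule swap)
  show ?thesis
    by (subst (1 2 3) G_decompose) (simp only: G_add_11 G_add_12 sw.G_add_11 sw.G_add_12 add_ac)
qed

lemma G_jordan: "G (x \<odot> y) = G x \<odot> y + x \<odot> G y"
proof (rule double_cancel)
  show "G (x \<odot> y) + G (x \<odot> y) = G x \<odot> y + x \<odot> G y + (G x \<odot> y + x \<odot> G y)"
    using double_test[of x y] by (simp add: G_add jordan_add_right algebra_simps)
qed

section \<open>Vanishing of the Leibniz defect\<close>

lemma G_12_off: "e * G (e * x * f) * e = 0" "f * G (e * x * f) * f = 0"
proof -
  let ?g = "G (e * x * f)"
  have o: "e \<odot> (e * x * f) = e * x * f" by (simp add: jordan_prod_def mult.assoc)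
  have g: "?g = e * ?g * f + f * ?g * e" using G_off[OF o] off_part[of ?g] by simp
  show "e * G (e * x * f) * e = 0" by (subst g) (simp add: algebra_simps)
  show "f * G (e * x * f) * f = 0" by (subst g) (simp add: algebra_simps)
qed

text \<open>
  Write \<open>g b\<close> for the \<open>f A e\<close> part of \<open>G b\<close>. Elements of \<open>e A f\<close> have zero Jordan products, which gives
  \<open>g b c + g c b = 0\<close> and \<open>b g b = 0\<close>, while \<open>a \<odot> b = a b\<close> for \<open>a\<close> in \<open>e A e\<close> gives \<open>g (a b) = g b a\<close>.
  Hence \<open>c g b a c = - c g c a b = 0\<close> for all \<open>a\<close>, and primeness is used first for \<open>c g b = 0\<close> and then for
  \<open>g b = 0\<close>.
\<close>

lemma G_12_no_21: "f * G (e * x * f) * e = 0"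
proof -
  let ?b = "e * x * f"
  have rel: "f * G (e * u * f) * (e * v * f) + f * G (e * v * f) * (e * u * f) = 0"
    and rel': "(e * v * f) * G (e * u * f) * e + (e * u * f) * G (e * v * f) * e = 0" for u v
  proof -
    have "(e * u * f) \<odot> (e * v * f) = 0" by (simp add: jordan_prod_def mult.assoc)
    then have z: "G (e * u * f) \<odot> (e * v * f) + (e * u * f) \<odot> G (e * v * f) = 0"
      using G_jordan[of "e * u * f" "e * v * f"] by simp
    show "f * G (e * u * f) * (e * v * f) + f * G (e * v * f) * (e * u * f) = 0"
      using arg_cong[OF z, of "\<lambda>w. f * w"] by (simp add: jordan_prod_def algebra_simps)
    show "(e * v * f) * G (e * u * f) * e + (e * u * f) * G (e * v * f) * e = 0"
      using arg_cong[OF z, of "\<lambda>w. w * e"] by (simp add: jordan_prod_def algebra_simps)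
  qed
  have sq: "(e * u * f) * G (e * u * f) * e = 0" for u
    by (rule double_zero) (rule rel')
  have mod: "f * G (e * (z * e * x) * f) * e = f * G ?b * (e * z * e)" for z
  proof -
    have "(e * z * e) \<odot> ?b = e * (z * e * x) * f" by (simp add: jordan_prod_def mult.assoc)
    then have "G (e * (z * e * x) * f) = G (e * z * e) \<odot> ?b + (e * z * e) \<odot> G ?b"
      using G_jordan[of "e * z * e" ?b] by simp
    moreover have "f * (G (e * z * e) * w) = 0" for w
      using G_11(1)[of z] by (simp add: mult.assoc[symmetric])
    ultimately show ?thesis
      by (simp add: jordan_prod_def algebra_simps G_11)
  qed
  have "(e * y * f) * G ?b * e = 0" for y
  proof -
    let ?c = "e * y * f"
    have "?c * G ?b * e * z * ?c = 0" for z
    proof -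
      have 1: "f * G (e * (z * e * x) * f) * ?c + f * G ?c * (e * (z * e * x) * f) = 0"
        by (rule rel)
      have "f * G (e * (z * e * x) * f) * ?c = f * G (e * (z * e * x) * f) * e * ?c"
        by (simp add: mult.assoc)
      then have 2: "f * G ?b * (e * z * e) * ?c + f * G ?c * (e * (z * e * x) * f) = 0"
        using 1 by (simp only: mod)
      have "?c * G ?c * (e * (z * e * x) * f) = ?c * G ?c * e * ((z * e * x) * f)"
        by (simp add: mult.assoc)
      then have 3: "?c * G ?c * (e * (z * e * x) * f) = 0" by (simp only: sq) simp
      have "?c * G ?b * e * z * ?c
          = ?c * (f * G ?b * (e * z * e) * ?c + f * G ?c * (e * (z * e * x) * f))
            - ?c * G ?c * (e * (z * e * x) * f)"
        by (simp add: algebra_simps)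
      then show ?thesis using 2 3 by simp
    qed
    then have "(?c * G ?b * e) * z * (?c * G ?b * e) = 0" for z
      by (metis mult.assoc mult_zero_left)
    then show ?thesis using prime[of "?c * G ?b * e" "?c * G ?b * e"] by blast
  qed
  then have "e * y * (f * G ?b * e) = 0" for y by (simp add: mult.assoc)
  then show ?thesis using prime[of e "f * G ?b * e"] e_nz by blast
qed

lemma G_12: "e * G (e * x * f) = G (e * x * f)" "f * G (e * x * f) = 0"
  using G_12_off[of x] G_12_no_21[of x] split_right[of "f * G (e * x * f)"]
    split_left[of "G (e * x * f)"] by simp_all

lemma G_e_left: "G (e * x) = e * G x"
proof -
  interpret sw: jordan_pexider f e D G by (rule swap)
  have "G (e * x) = G (e * x * e) + G (e * x * f)"
    by (subst G_decompose) (simp add: mult.assoc)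
  also have "\<dots> = e * G x"
    by (subst (2) G_decompose) (simp add: distrib_left G_11 sw.G_11 G_12 sw.G_12)
  finally show ?thesis .
qed

lemma G_e_right: "G (x * e) = G x * e"
  using G_jordan[of e x] by (simp add: jordan_prod_def G_add G_e_left)

definition leibniz_defect :: "'a \<Rightarrow> 'a \<Rightarrow> 'a" where
  "leibniz_defect x y = G (x * y) - G x * y - x * G y"

lemma leibniz_defect_antisym: "leibniz_defect x y = - leibniz_defect y x"
  using G_jordan[of x y] by (simp add: leibniz_defect_def jordan_prod_def G_add algebra_simps)

lemma leibniz_defect_add_left: "leibniz_defect (x + y) z = leibniz_defect x z + leibniz_defect y z"
  by (simp add: leibniz_defect_def G_add algebra_simps)

lemma leibniz_defect_e_left: "leibniz_defect (e * x) y = e * leibniz_defect x y"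
  by (simp add: leibniz_defect_def G_e_left algebra_simps)

lemma leibniz_defect_e_right: "leibniz_defect x (y * e) = leibniz_defect x y * e"
  using G_e_right[of "x * y"] by (simp add: leibniz_defect_def G_e_right algebra_simps)

lemma leibniz_defect_e_middle: "leibniz_defect (x * e) y = leibniz_defect x (e * y)"
  by (simp add: leibniz_defect_def G_e_left G_e_right algebra_simps)

lemma leibniz_defect_e_second: "leibniz_defect x (e * y) = e * leibniz_defect x y"
  by (metis leibniz_defect_antisym leibniz_defect_e_left mult_minus_right)

lemma leibniz_defect_cocycle:
  "leibniz_defect x y * z = x * leibniz_defect y z - leibniz_defect (x * y) z + leibniz_defect x (y * z)"
  by (simp add: leibniz_defect_def algebra_simps)

text \<open>
  Bringing \<open>f\<close> to the second slot and then out on the left, where \<open>e\<close> already stands, produces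
  \<open>e * f = 0\<close>.
\<close>

lemma leibniz_defect_12: "leibniz_defect (e * x * f) y = 0"
proof -
  interpret sw: jordan_pexider f e D G by (rule swap)
  have "leibniz_defect (e * x * f) y = e * (f * leibniz_defect x y)"
    by (simp only: mult.assoc leibniz_defect_e_left)
       (simp only: sw.leibniz_defect_e_middle
         sw.leibniz_defect_e_second)
  then show ?thesis by simp
qed

text \<open>
  Multiply by \<open>c\<close> in \<open>e A f\<close> and expand by the cocycle identity: all terms on the right-hand side
  have an element of \<open>e A f\<close> in one slot, after \<open>e\<close> has been moved across in the last one. So the defect times \<open>e\<close> vanishes, and the defect itself
  is a right multiple of \<open>e\<close>.
\<close>

lemma leibniz_defect_11: "leibniz_defect (e * x * e) y = 0"
proof -
  interpret sw: jordan_pexider f e D G by (rule swap)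
  have r: "leibniz_defect y (e * u * f) = 0" for y u
    using leibniz_defect_antisym leibniz_defect_12 by (metis neg_0_equal_iff_equal)
  have l: "leibniz_defect (e * x * e) y = leibniz_defect x y * e" for x y
  proof -
    have "leibniz_defect (e * x * e) y = e * leibniz_defect x (e * y)"
      by (simp only: mult.assoc leibniz_defect_e_left leibniz_defect_e_middle)
    also have "\<dots> = leibniz_defect x (e * y)" by (simp add: leibniz_defect_e_second)
    also have "\<dots> = - leibniz_defect y (x * e)" by (metis leibniz_defect_e_middle leibniz_defect_antisym)
    also have "\<dots> = leibniz_defect x y * e"
      by (metis leibniz_defect_e_right leibniz_defect_antisym mult_minus_left)
    finally show ?thesis .
  qed
  have "leibniz_defect (e * x * e) y * (e * z * f) = 0" for z
  proof -
    have "leibniz_defect (e * x * e) (y * (e * z * f)) = e * leibniz_defect x (e * (y * (e * z * f)))"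
      by (simp only: mult.assoc leibniz_defect_e_left leibniz_defect_e_middle)
    also have "e * (y * (e * z * f)) = e * (y * e * z) * f" by (simp add: mult.assoc)
    finally show ?thesis by (simp add: leibniz_defect_cocycle[of "e * x * e" y] r)
  qed
  then have "leibniz_defect (e * x * e) y * e = 0" by (rule annihilates_corner_right)
  moreover have "leibniz_defect (e * x * e) y * e = leibniz_defect (e * x * e) y"
    unfolding l by (simp add: mult.assoc)
  ultimately show ?thesis by simp
qed

lemma G_mult: "G (x * y) = G x * y + x * G y"
proof -
  interpret sw: jordan_pexider f e D G by (rule swap)
  have "leibniz_defect x y = 0"
    by (subst peirce_decomposition[of x])
      (simp add: leibniz_defect_add_left leibniz_defect_11 leibniz_defect_12
         sw.leibniz_defect_11
         sw.leibniz_defect_12)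
  then show ?thesis by (simp add: leibniz_defect_def algebra_simps)
qed

end

section \<open>Normalization of a general solution\<close>

context peirce
begin

text \<open>
  Since \<open>g \<odot> g = g \<odot> 1\<close> for an idempotent \<open>g\<close>, the equation yields \<open>G g \<odot> g + g \<odot> G g = 2 G g + g \<odot> G 1\<close>.
  On the off-diagonal parts relative to \<open>g\<close> the terms in \<open>G g\<close> cancel, so \<open>G 1\<close> has none.
\<close>

lemma pexider_value_at_one:
  assumes pex: "\<And>x y. D (x \<odot> y) = G x \<odot> y + x \<odot> G (y::'a)"
  shows "G 1 \<in> ring_center"
proof (rule central_if_commutes_with_idempotents)
  fix g :: 'a assume g: "g * g = g"
  have gg: "g * (g * w) = g * w" for w using g by (simp add: mult.assoc[symmetric])
  have "D (g \<odot> g) = D (g \<odot> 1)" using g by (simp add: jordan_prod_def)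
  then have E: "G g \<odot> g + g \<odot> G g = G g + G g + g \<odot> G 1" unfolding pex by simp
  have "g * G 1 = g * G 1 * g"
    using arg_cong[OF E, of "\<lambda>w. g * w - g * w * g"] by (simp add: jordan_prod_def algebra_simps g gg)
  moreover have "G 1 * g = g * G 1 * g"
    using arg_cong[OF E, of "\<lambda>w. w * g - g * w * g"] by (simp add: jordan_prod_def algebra_simps g gg)
  ultimately show "G 1 * g = g * G 1" by simp
qed

text \<open>
  Subtracting \<open>G 1 * x\<close> from \<open>G x\<close> and \<open>2 * G 1 * x\<close> from \<open>D x\<close> preserves the equation as \<open>G 1\<close> is central.
  The value \<open>p\<close> at \<open>e\<close> is then off-diagonal and therefore equals the value at \<open>e\<close> of the inner derivation by
  \<open>[p, e]\<close>, which can be subtracted from both functions.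
\<close>

lemma pexider_jordan_derivation:
  assumes pex: "\<And>x y. D (x \<odot> y) = G x \<odot> y + x \<odot> G (y::'a)"
  shows "ring_derivation (\<lambda>x. G x - G 1 * x)"
proof -
  define z where "z = G 1"
  have z: "z * x = x * z" for x
    using pexider_value_at_one[OF pex] by (simp add: ring_center_def z_def)
  have zz: "x * (z * y) = z * (x * y)" for x y
    using z[of x] by (metis mult.assoc)
  define G1 where "G1 x = G x - z * x" for x
  define D1 where "D1 x = D x - (z * x + z * x)" for x
  have pex1: "D1 (x \<odot> y) = G1 x \<odot> y + x \<odot> G1 y" for x y
  proof -
    have "D1 (x \<odot> y) = G x \<odot> y + x \<odot> G y - (z * (x \<odot> y) + z * (x \<odot> y))"
      by (simp add: D1_def pex)
    then show ?thesis by (simp add: G1_def jordan_prod_def algebra_simps z[symmetric] zz)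
  qed
  have G11: "G1 1 = 0" by (simp add: G1_def z_def)
  define p where "p = G1 e"
  have "D1 (e \<odot> e) = D1 (e \<odot> 1)" by (simp add: jordan_prod_def)
  then have "p \<odot> e + p \<odot> e = p + p"
    by (simp only: pex1 G11) (simp add: p_def[symmetric] jordan_commute[of e])
  then have pe: "p \<odot> e = p" by (rule double_cancel)
  have "e * (p \<odot> e) * e = e * p * e + e * p * e"
    by (simp add: jordan_prod_def algebra_simps)
  then have epe: "e * p * e = 0" unfolding pe by simp
  define u where "u = p * e - e * p"
  define G2 where "G2 x = G1 x - (u * x - x * u)" for x
  define D2 where "D2 x = D1 x - (u * x - x * u)" for x
  have pex2: "D2 (x \<odot> y) = G2 x \<odot> y + x \<odot> G2 y" for x y
  proof -
    have "D2 (x \<odot> y) = G1 x \<odot> y + x \<odot> G1 y - (u * (x \<odot> y) - (x \<odot> y) * u)"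
      by (simp add: D2_def pex1)
    then show ?thesis by (simp add: G2_def jordan_prod_def algebra_simps)
  qed
  have "u * e - e * u = p"
    using pe epe by (simp add: u_def jordan_prod_def algebra_simps)
  then have G2e: "G2 e = 0" by (simp add: G2_def p_def[symmetric])
  have G21: "G2 1 = 0" by (simp add: G2_def G11)
  have D20: "D2 0 = 0"
  proof -
    have "D2 (0 \<odot> 0) = 0" unfolding pex2 by simp
    then show ?thesis by simp
  qed
  have G2f: "G2 f = 0"
  proof -
    have "e \<odot> G2 f = D2 (e \<odot> f)" by (simp add: pex2 G2e)
    also have "\<dots> = 0" by (simp add: jordan_prod_def D20)
    finally have e: "e \<odot> G2 f = 0" .
    have "D2 (f \<odot> f) = D2 (f \<odot> 1)" by (simp add: jordan_prod_def)
    then have "f \<odot> G2 f + f \<odot> G2 f = G2 f + G2 f"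
      by (simp only: pex2 G21) (simp add: jordan_commute[of f])
    then have "f \<odot> G2 f = G2 f" by (rule double_cancel)
    with e jordan_split[of "G2 f"] show ?thesis by simp
  qed
  interpret jordan_pexider e f D2 G2
    by unfold_locales (fact pex2 G2e G2f)+
  have G1: "G1 = (\<lambda>x. G2 x + (u * x - x * u))" by (simp add: G2_def)
  have "ring_derivation G1"
    unfolding G1 by (simp add: ring_derivation_def additive_def G_add G_mult algebra_simps)
  then show ?thesis by (simp add: G1_def[abs_def] z_def)
qed

end

section \<open>Specialization to two variables\<close>

lemma jordan_q_collapse:
  "jordan_q (Suc (Suc k)) u = jordan_q (Suc k) (\<lambda>i. if i = 1 then u 1 \<odot> u 2 else u (Suc i))"
  by (induction k) (simp_all add: numeral_2_eq_2)

lemma jordan_q_cong: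
  "(\<And>i. i \<noteq> 0 \<Longrightarrow> u i = v i) \<Longrightarrow> jordan_q (Suc k) u = jordan_q (Suc k) v"
  by (induction k) simp_all

lemma jordan_q_ones: "jordan_q (Suc k) (\<lambda>i. if i = 1 then x else 1) = 2 ^ k * x"
  by (induction k) (simp_all add: mult_2 distrib_right)

definition two_then_ones :: "'a::ring_1 \<Rightarrow> 'a \<Rightarrow> nat \<Rightarrow> 'a" where
  "two_then_ones x y = (\<lambda>i. if i = 1 then x else if i = 2 then y else 1)"

lemma jordan_q_two_then_ones:
  "jordan_q (Suc (Suc k)) (two_then_ones x y) = 2 ^ k * (x \<odot> y)"
proof -
  have "jordan_q (Suc (Suc k)) (two_then_ones x y) = jordan_q (Suc k) (\<lambda>i. if i = 1 then x \<odot> y else 1)"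
    unfolding jordan_q_collapse by (rule jordan_q_cong) (simp add: two_then_ones_def)
  then show ?thesis by (simp only: jordan_q_ones)
qed

text \<open>
  In each summand with \<open>i \<ge> 3\<close> the first two arguments enter through \<open>x \<odot> y\<close> only, so these
  summands form a function \<open>R\<close> of the product.
\<close>

lemma jordan_q_two_then_ones_rest:
  obtains R :: "'a::ring_1 \<Rightarrow> 'a"
  where "\<And>x y. (\<Sum>i=2..Suc (Suc k). jordan_q (Suc (Suc k)) ((two_then_ones x y)(i := \<delta> (two_then_ones x y i))))
       = 2 ^ k * (x \<odot> \<delta> y) + R (x \<odot> y)"
proof
  \<comment> \<open>Collapsing the first two arguments shifts positions down by one; \<open>0\<close> is a dummy for the unread entry.\<close>
  define R where "R w = (\<Sum>i=3..Suc (Suc k). jordan_q (Suc k)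
      (\<lambda>j. if j = 1 then w else if Suc j = i then \<delta> 1 else if j = 0 then 0 else 1))" for w
  fix x y :: 'a
  let ?q = "\<lambda>i. jordan_q (Suc (Suc k)) ((two_then_ones x y)(i := \<delta> (two_then_ones x y i)))"
  have "{2..Suc (Suc k)} = insert 2 {3..Suc (Suc k)}" by auto
  then have "(\<Sum>i=2..Suc (Suc k). ?q i) = ?q 2 + (\<Sum>i=3..Suc (Suc k). ?q i)" by simp
  also have "?q 2 = 2 ^ k * (x \<odot> \<delta> y)"
  proof -
    have "(two_then_ones x y)(2 := \<delta> (two_then_ones x y 2)) = two_then_ones x (\<delta> y)"
      by (auto simp: two_then_ones_def fun_eq_iff)
    then show ?thesis by (simp only: jordan_q_two_then_ones)
  qed
  also have "(\<Sum>i=3..Suc (Suc k). ?q i) = R (x \<odot> y)"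
    unfolding R_def jordan_q_collapse
    by (intro sum.cong refl jordan_q_cong) (auto simp: two_then_ones_def)
  finally show "(\<Sum>i=2..Suc (Suc k). ?q i) = 2 ^ k * (x \<odot> \<delta> y) + R (x \<odot> y)" .
qed

lemma jordan_power_two:
  "(2 ^ k * x) \<odot> y = 2 ^ k * (x \<odot> y)" "x \<odot> (2 ^ k * y) = 2 ^ k * (x \<odot> (y::'a::ring_1))"
proof -
  have c: "x * (2 ^ k * y) = 2 ^ k * (x * y)" for x y :: 'a
    by (induction k arbitrary: y) (simp_all add: mult_2 mult.assoc mult_2_right algebra_simps)
  show "(2 ^ k * x) \<odot> y = 2 ^ k * (x \<odot> y)" "x \<odot> (2 ^ k * y) = 2 ^ k * (x \<odot> y)"
    by (simp_all add: jordan_prod_def c algebra_simps)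
qed

context prime_ring_two_free
begin

lemma power_two_eq: "2 ^ k * x = 2 ^ k * y \<Longrightarrow> x = (y::'a)"
  using power_two_cancel[of k "x - y"] by (simp add: right_diff_distrib)

lemma power_two_commute: "x * 2 ^ k = 2 ^ k * (x::'a)"
  by (metis mult_of_nat_commute of_nat_numeral of_nat_power)

lemma derivation_of_power_two_multiple:
  assumes "ring_derivation (\<lambda>x. 2 ^ k * d (x::'a))"
  shows "ring_derivation d"
proof -
  have "d (x + y) = d x + d y" for x y
    by (rule power_two_eq[of k]) (use assms in \<open>simp add: ring_derivation_def additive_def distrib_left\<close>)
  moreover have "d (x * y) = d x * y + x * d y" for x y
  proof (rule power_two_eq[of k])
    have "x * (2 ^ k * d y) = 2 ^ k * (x * d y)" by (metis power_two_commute mult.assoc)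
    then show "2 ^ k * d (x * y) = 2 ^ k * (d x * y + x * d y)"
      using assms by (simp add: ring_derivation_def distrib_left mult.assoc)
  qed
  ultimately show ?thesis by (simp add: ring_derivation_def additive_def)
qed

lemma centre_of_power_two_multiple:
  assumes "2 ^ k * (c::'a) \<in> ring_center" shows "c \<in> ring_center"
proof -
  have "c * x = x * c" for x
  proof (rule power_two_eq[of k])
    have "2 ^ k * (c * x) = x * (2 ^ k * c)" using assms by (simp add: ring_center_def mult.assoc)
    then show "2 ^ k * (c * x) = 2 ^ k * (x * c)" by (metis power_two_commute mult.assoc)
  qed
  then show ?thesis by (simp add: ring_center_def)
qed

text \<open>
  The cases \<open>y = 1\<close> and \<open>x = 1\<close> together give \<open>2 F x = F 1 \<odot> x\<close>. Since \<open>F x \<odot> y\<close> is symmetric in \<open>x\<close> and \<open>y\<close>,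
  \<open>(F 1 \<odot> x) \<odot> y - (F 1 \<odot> y) \<odot> x = [F 1, [x, y]]\<close> vanishes.
\<close>

lemma jordan_multiplier:
  assumes eq: "\<And>x y. H (x \<odot> y) = F x \<odot> (y::'a)"
  shows "F 1 \<in> ring_center" "F x = F 1 * x"
proof -
  have tw: "F x + F x = F 1 \<odot> x" for x
    using eq[of x 1] eq[of 1 x] by simp
  have sym: "(F 1 \<odot> x) \<odot> y = (F 1 \<odot> y) \<odot> x" for x y
    using eq[of x y] eq[of y x] by (simp add: tw[symmetric] jordan_add_left jordan_commute[of y x])
  show c: "F 1 \<in> ring_center"
  proof (rule central_if_commutes_with_commutators)
    fix s t
    show "F 1 * (s * t - t * s) = (s * t - t * s) * F 1"
      using sym[of s t] by (simp add: jordan_prod_def algebra_simps)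
  qed
  show "F x = F 1 * x"
    by (rule double_cancel) (use tw[of x] c in \<open>simp add: jordan_prod_def ring_center_def\<close>)
qed

end

theorem corollary4p6:
  fixes n :: nat and \<Delta> :: "'a::ring_1 \<Rightarrow> 'a"
  assumes "n \<ge> 2"
    and "two_torsion_free TYPE('a)"
    and "is_prime_ring TYPE('a)"
    and "\<exists>e::'a. nontrivial_idempotent e"
    and "mult_gen_jordan_derivation n \<Delta>"
  shows "\<exists>\<mu> \<delta>. \<mu> \<in> ring_center \<and> ring_derivation \<delta> \<and> (\<forall>t. \<Delta> t = \<mu> * t + \<delta> t)"
proof -
  obtain k where n: "n = Suc (Suc k)"
    using assms(1) that[of "n - 2"] by simp
  obtain e :: 'a where e: "e * e = e" "e \<noteq> 0" "e \<noteq> 1"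
    using assms(4) by (auto simp: nontrivial_idempotent_def)
  interpret prime_ring_two_free "TYPE('a)"
  proof
    show "x = 0" if "x + x = 0" for x :: 'a
      using that assms(2) unfolding two_torsion_free_def mult_2 by blast
    show "u = 0 \<or> v = 0" if "\<And>x. u * x * v = 0" for u v :: 'a
      using that assms(3) unfolding is_prime_ring_def by blast
  qed
  interpret peirce e "1 - e"
    by unfold_locales (use e in \<open>auto simp: algebra_simps\<close>)
  obtain \<delta> where \<delta>: "\<And>t. \<delta> (jordan_q n t) = (\<Sum>i=1..n. jordan_q n (t(i := \<delta> (t i))))"
    and \<Delta>: "\<And>t. \<Delta> (jordan_q n t) =
        jordan_q n (t(1 := \<Delta> (t 1))) + (\<Sum>i=2..n. jordan_q n (t(i := \<delta> (t i))))"
    using assms(5) unfolding mult_gen_jordan_derivation_def mult_jordan_derivation_def by blast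
  obtain R where R: "\<And>x y. (\<Sum>i=2..n. jordan_q n ((two_then_ones x y)(i := \<delta> (two_then_ones x y i))))
       = 2 ^ k * (x \<odot> \<delta> y) + R (x \<odot> y)"
    unfolding n using jordan_q_two_then_ones_rest[of k \<delta>] by blast
  have upd: "jordan_q n ((two_then_ones x y)(1 := h (two_then_ones x y 1))) = 2 ^ k * (h x \<odot> y)"
    for h x y
  proof -
    have "(two_then_ones x y)(1 := h (two_then_ones x y 1)) = two_then_ones (h x) y"
      by (auto simp: two_then_ones_def fun_eq_iff)
    then show ?thesis by (simp only: n jordan_q_two_then_ones)
  qed
  have q2: "jordan_q n (two_then_ones x y) = 2 ^ k * (x \<odot> y)" for x y :: 'a
    by (simp only: n jordan_q_two_then_ones)
  have \<Delta>2: "\<Delta> (2 ^ k * (x \<odot> y)) = 2 ^ k * (\<Delta> x \<odot> y) + 2 ^ k * (x \<odot> \<delta> y) + R (x \<odot> y)" for x y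
    using \<Delta>[of "two_then_ones x y"] unfolding R upd q2 by (simp only: add.assoc)
  have \<delta>2: "\<delta> (2 ^ k * (x \<odot> y)) = 2 ^ k * (\<delta> x \<odot> y) + 2 ^ k * (x \<odot> \<delta> y) + R (x \<odot> y)" for x y
  proof -
    have S: "(\<Sum>i=1..n. h i) = h 1 + (\<Sum>i=2..n. h i)" for h :: "nat \<Rightarrow> 'a"
      using assms(1) by (simp add: sum.atLeast_Suc_atMost numeral_2_eq_2)
    show ?thesis
      using \<delta>[of "two_then_ones x y"] unfolding S R upd q2 by (simp only: add.assoc)
  qed
  define G where "G x = 2 ^ k * \<delta> x" for x
  define D where "D x = \<delta> (2 ^ k * x) - R x" for x
  have "D (x \<odot> y) = G x \<odot> y + x \<odot> G y" for x y
    by (simp add: D_def G_def \<delta>2 jordan_power_two)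
  note G = pexider_value_at_one[of D G, OF this] pexider_jordan_derivation[of D G, OF this]
  define d where "d x = \<delta> x - \<delta> 1 * x" for x
  have c\<delta>: "\<delta> 1 \<in> ring_center"
    using G(1) centre_of_power_two_multiple unfolding G_def by blast
  have d: "ring_derivation d"
    by (rule derivation_of_power_two_multiple[of k])
      (use G(2) in \<open>simp add: G_def d_def right_diff_distrib mult.assoc\<close>)
  define F where "F x = 2 ^ k * (\<Delta> x - \<delta> x)" for x
  define H where "H x = \<Delta> (2 ^ k * x) - \<delta> (2 ^ k * x)" for x
  have "H (x \<odot> y) = F x \<odot> y" for x y
    by (simp add: H_def F_def \<Delta>2 \<delta>2 jordan_power_two jordan_diff_left right_diff_distrib)
  note F = jordan_multiplier[of H F, OF this]
  define a where "a = \<Delta> 1 - \<delta> 1"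
  have a: "a \<in> ring_center"
    using F(1) centre_of_power_two_multiple unfolding F_def a_def by blast
  have aF: "\<Delta> x - \<delta> x = a * x" for x
    by (rule power_two_eq[of k]) (use F(2)[of x] in \<open>simp add: F_def a_def mult.assoc\<close>)
  have "a + \<delta> 1 \<in> ring_center"
    using a c\<delta> by (simp add: ring_center_def algebra_simps)
  moreover have "\<Delta> t = (a + \<delta> 1) * t + d t" for t
    using aF[of t] by (simp add: d_def algebra_simps)
  ultimately show ?thesis using d by blast
qed

end
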